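(* Let $\mathcal{S}$ be a closed, connected, orientable two-dimensional smooth manifold. Then any smooth map $A:\mathcal{S}\to SL(2,\mathbb{C})$ is homotopic to the identity map $I:\mathcal{S}\to SL(2,\mathbb{C})$, $p\mapsto\mathrm{diag}(1,1)$, i.e. to the constant map whose value is the identity matrix.
   Context: Closed means compact without boundary. Two maps $A_0,A_1:\mathcal{S}\to G$ into a topological group $G$ are homotopic if there is a continuous map $\mathcal{S}\times[0,1]\to G$, $(p,t)\mapsto A_t(p)$, which restricts to $A_0$ at $t=0$ and to $A_1$ at $t=1$. *)

theory Defs
  imports "HOL-Analysis.Analysis"
begin

text \<open>The class \<open>C\<^sup>k\<close> on a set \<open>U\<close>, meant for open \<open>U\<close> in a Euclidean space:
  \<open>f\<close> is \<open>C\<^sup>k\<^sup>+\<^sup>1\<close> iff it is Frechet differentiable on \<open>U\<close> and each of its directional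
  derivatives is \<open>C\<^sup>k\<close>.  Values of \<open>f\<close> outside the open set \<open>U\<close> play no role.\<close>

primrec Ck_on :: "nat \<Rightarrow> 'a::euclidean_space set \<Rightarrow> ('a \<Rightarrow> 'b::real_normed_vector) \<Rightarrow> bool" where
  "Ck_on 0 U f \<longleftrightarrow> continuous_on U f"
| "Ck_on (Suc k) U f \<longleftrightarrow>
     (\<forall>x\<in>U. f differentiable (at x)) \<and> (\<forall>v. Ck_on k U (\<lambda>x. frechet_derivative f (at x) v))"

definition smooth_on :: "'a::euclidean_space set \<Rightarrow> ('a \<Rightarrow> 'b::real_normed_vector) \<Rightarrow> bool" where
  "smooth_on U f \<longleftrightarrow> (\<forall>k. Ck_on k U f)"

text \<open>A chart is a pair of a domain \<open>U\<close> and a coordinate map; the coordinate map is a total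
  function, but only its restriction to \<open>U\<close> is meaningful.\<close>

type_synonym ('a, 'n) chart = "'a set \<times> ('a \<Rightarrow> real ^ 'n)"

definition is_chart :: "'a topology \<Rightarrow> ('a, 'n::finite) chart \<Rightarrow> bool" where
  "is_chart M c \<longleftrightarrow> (case c of (U, \<phi>) \<Rightarrow>
     openin M U \<and> open (\<phi> ` U) \<and>
     homeomorphic_map (subtopology M U) (top_of_set (\<phi> ` U)) \<phi>)"

definition transition :: "('a, 'n) chart \<Rightarrow> ('a, 'n) chart \<Rightarrow> real ^ 'n \<Rightarrow> real ^ 'n" where
  "transition c d = snd d \<circ> inv_into (fst c) (snd c)"

definition overlap :: "('a, 'n) chart \<Rightarrow> ('a, 'n) chart \<Rightarrow> (real ^ 'n) set" where
  "overlap c d = snd c ` (fst c \<inter> fst d)"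

definition smooth_atlas :: "'a topology \<Rightarrow> ('a, 'n::finite) chart set \<Rightarrow> bool" where
  "smooth_atlas M \<A> \<longleftrightarrow>
     (\<forall>c\<in>\<A>. is_chart M c) \<and> (\<Union>c\<in>\<A>. fst c) = topspace M \<and>
     (\<forall>c\<in>\<A>. \<forall>d\<in>\<A>. smooth_on (overlap c d) (transition c d))"

text \<open>The atlas \<open>\<A>\<close> need not be maximal: it represents the smooth structure consisting of all
  charts smoothly compatible with it.  The dimension is the cardinality of the index type \<open>'n\<close>.\<close>

definition smooth_manifold :: "'a topology \<Rightarrow> ('a, 'n::finite) chart set \<Rightarrow> bool" where
  "smooth_manifold M \<A> \<longleftrightarrow> Hausdorff_space M \<and> second_countable M \<and> smooth_atlas M \<A>"

definition oriented_atlas :: "('a, 'n::finite) chart set \<Rightarrow> bool" where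
  "oriented_atlas \<B> \<longleftrightarrow> (\<forall>c\<in>\<B>. \<forall>d\<in>\<B>. \<forall>x\<in>overlap c d.
     det (matrix (frechet_derivative (transition c d) (at x))) > 0)"

text \<open>The condition on \<open>\<A> \<union> \<B>\<close> says that \<open>\<B>\<close> belongs to the smooth structure of \<open>\<A>\<close>.\<close>

definition orientable :: "'a topology \<Rightarrow> ('a, 'n::finite) chart set \<Rightarrow> bool" where
  "orientable M \<A> \<longleftrightarrow>
     (\<exists>\<B>. smooth_atlas M \<B> \<and> smooth_atlas M (\<A> \<union> \<B>) \<and> oriented_atlas \<B>)"

text \<open>Smooth maps from a manifold into a subset \<open>Y\<close> of a Euclidean space.  When \<open>Y\<close> is an embedded
  submanifold, these are exactly the smooth maps into the manifold \<open>Y\<close>.\<close>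

definition smooth_map_into ::
  "'a topology \<Rightarrow> ('a, 'n::finite) chart set \<Rightarrow> 'b::euclidean_space set \<Rightarrow> ('a \<Rightarrow> 'b) \<Rightarrow> bool" where
  "smooth_map_into M \<A> Y f \<longleftrightarrow> f ` topspace M \<subseteq> Y \<and>
     (\<forall>(U, \<phi>)\<in>\<A>. smooth_on (\<phi> ` U) (f \<circ> inv_into U \<phi>))"

text \<open>\<open>SL(2,\<complex>)\<close> is an embedded submanifold of the Euclidean space of complex \<open>2 \<times> 2\<close> matrices.\<close>

definition SL2C :: "(complex ^ 2 ^ 2) set" where
  "SL2C = {B. det B = 1}"

end

theory Submission
  imports Defs
begin

text \<open>A matrix in \<open>SL(2,\<complex>)\<close> has a nonzero first column, and the matrices with a given first column
  form an affine space. Hence \<open>A\<close> is determined up to homotopy by its first column, a map \<open>v\<close> into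
  \<open>\<complex>\<^sup>2 - {0}\<close>. Since \<open>v\<close> is smooth on a surface, the real cone over its image
  has measure zero in the four-dimensional space \<open>\<complex>\<^sup>2\<close>. Some \<open>u\<close> therefore lies outside this cone, and
  \<open>v\<close> can be moved along straight lines to the constant \<open>-u\<close> without passing through \<open>0\<close>.\<close>

lemma smooth_on_imp_differentiable:
  "smooth_on U f \<Longrightarrow> x \<in> U \<Longrightarrow> f differentiable (at x)"
  unfolding smooth_on_def by (metis Ck_on.simps(2))

text \<open>Continuity is local. On a chart domain \<open>f\<close> is the coordinate map followed
  by its local representative, which is continuous as the case \<open>k = 0\<close> of smoothness;
  the open chart domains cover \<open>M\<close>, so the pieces paste together.\<close>

lemma smooth_map_into_imp_continuous_map:
  assumes "smooth_atlas M \<A>" and "smooth_map_into M \<A> Y f"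
  shows "continuous_map M (top_of_set Y) f"
proof -
  have "continuous_map (subtopology M (fst c)) euclidean f" if c: "c \<in> \<A>" for c
  proof -
    obtain U \<phi> where c_eq: "c = (U, \<phi>)" by fastforce
    have chart: "homeomorphic_map (subtopology M U) (top_of_set (\<phi> ` U)) \<phi>" and UM: "openin M U"
      using assms(1) c unfolding smooth_atlas_def is_chart_def c_eq by auto
    have "smooth_on (\<phi> ` U) (f \<circ> inv_into U \<phi>)"
      using assms(2) c unfolding smooth_map_into_def c_eq by auto
    then have "continuous_on (\<phi> ` U) (f \<circ> inv_into U \<phi>)"
      unfolding smooth_on_def by (metis Ck_on.simps(1))
    then have "continuous_map (subtopology M U) euclidean ((f \<circ> inv_into U \<phi>) \<circ> \<phi>)"
      using chart by (intro continuous_map_compose[of _ "top_of_set (\<phi> ` U)"])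
        (auto simp: homeomorphic_imp_continuous_map)
    moreover have "inj_on \<phi> U"
      using homeomorphic_imp_injective_map[OF chart] openin_subset[OF UM]
      by (simp add: inf.absorb2)
    ultimately show ?thesis
      unfolding c_eq fst_conv by (elim continuous_map_eq) auto
  qed
  moreover have "openin M (fst c)" if "c \<in> \<A>" for c
    using assms(1) that unfolding smooth_atlas_def is_chart_def by (cases c) auto
  moreover have "\<exists>c. c \<in> \<A> \<and> x \<in> fst c" if "x \<in> topspace M" for x
    using assms(1) that unfolding smooth_atlas_def by blast
  ultimately have "continuous_map M euclidean f"
    using pasting_lemma[of \<A> M fst euclidean "\<lambda>_. f" f] by blast
  then show ?thesis
    using assms(2) by (auto simp: continuous_map_in_subtopology smooth_map_into_def)
qed

text \<open>Over one chart the cone is the image of a differentiable map in the scalar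
  \<open>r\<close> and the \<open>n\<close> coordinates, hence null in a space of dimension above
  \<open>n + 1\<close>. Compactness leaves finitely many charts. The linear map \<open>L\<close>
  allows passing to a column of a matrix when smoothness is known for the matrix itself.\<close>

lemma negligible_cone_over_smooth_image:
  fixes \<A> :: "('a, 'n::finite) chart set" and L :: "'b::euclidean_space \<Rightarrow> 'c::euclidean_space"
  assumes "smooth_atlas M \<A>" and "compact_space M" and "smooth_map_into M \<A> Y f"
    and "linear L" and dim: "CARD('n) + 1 < DIM('c)"
  shows "negligible {r *\<^sub>R L (f p) | r p. p \<in> topspace M}"
proof -
  define cone where "cone U = (\<lambda>(r, p). r *\<^sub>R L (f p)) ` (UNIV \<times> U)" for U
  have negl: "negligible (cone U)" if "(U, \<phi>) \<in> \<A>" for U \<phi>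
  proof -
    let ?h = "f \<circ> inv_into U \<phi>"
    let ?F = "\<lambda>(r::real, y). r *\<^sub>R L (?h y)"
    have chart: "homeomorphic_map (subtopology M U) (top_of_set (\<phi> ` U)) \<phi>" and UM: "openin M U"
      using assms(1) that unfolding smooth_atlas_def is_chart_def by auto
    have inj: "inj_on \<phi> U"
      using homeomorphic_imp_injective_map[OF chart] openin_subset[OF UM]
      by (simp add: inf.absorb2)
    have smooth: "smooth_on (\<phi> ` U) ?h"
      using assms(3) that unfolding smooth_map_into_def by auto
    have "?F differentiable (at z)" if z: "z \<in> UNIV \<times> \<phi> ` U" for z
    proof -
      have "?h differentiable (at (snd z))"
        using smooth_on_imp_differentiable[OF smooth] z by auto
      then have "(?h \<circ> snd) differentiable (at z)"
        by (rule differentiable_chain_at[OF bounded_linear_imp_differentiable[OF bounded_linear_snd]])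
      then have "(L \<circ> (?h \<circ> snd)) differentiable (at z)"
        by (rule differentiable_chain_at[OF _ linear_imp_differentiable[OF \<open>linear L\<close>]])
      moreover have "fst differentiable (at z)"
        by (intro bounded_linear_imp_differentiable bounded_linear_fst)
      ultimately show ?thesis
        unfolding case_prod_unfold by (intro differentiable_scaleR) (auto simp: o_def)
    qed
    then have "?F differentiable_on (UNIV \<times> \<phi> ` U)"
      by (intro differentiable_at_imp_differentiable_on)
    then have "negligible (?F ` (UNIV \<times> \<phi> ` U))"
      using dim by (intro negligible_differentiable_image_lowdim) auto
    \<comment> \<open>Injectivity of \<open>\<phi>\<close> on \<open>U\<close> lets each
      \<open>p\<close> in \<open>U\<close> be recovered from its coordinates
      \<open>\<phi> p\<close>.\<close>
    moreover have "cone U \<subseteq> ?F ` (UNIV \<times> \<phi> ` U)"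
      using inj by (force simp: cone_def)
    ultimately show ?thesis
      by (rule negligible_subset)
  qed
  have "\<forall>U\<in>fst ` \<A>. openin M U" and "topspace M \<subseteq> \<Union>(fst ` \<A>)"
    using assms(1) unfolding smooth_atlas_def is_chart_def by auto
  then obtain \<F> where "finite \<F>" and \<F>: "\<F> \<subseteq> fst ` \<A>" and cover: "topspace M \<subseteq> \<Union>\<F>"
    using \<open>compact_space M\<close> unfolding compact_space_alt by meson
  then have "negligible (\<Union>(cone ` \<F>))"
    using negl by (intro negligible_Union) auto
  moreover have "{r *\<^sub>R L (f p) | r p. p \<in> topspace M} \<subseteq> \<Union>(cone ` \<F>)"
    using cover by (fastforce simp: cone_def)
  ultimately show ?thesis
    by (rule negligible_subset)
qed

text \<open>The straight-line homotopy for an abstract domain \<open>X\<close>. It is built once,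
  between the two projections on the set \<open>?K\<close> of endpoint pairs whose segment stays in
  \<open>T\<close>, and pulled back along \<open>x \<mapsto> (f x, g x)\<close>.\<close>

lemma homotopic_with_linear_topology:
  fixes f g :: "'a \<Rightarrow> 'b::real_normed_vector"
  assumes "continuous_map X euclidean f" and "continuous_map X euclidean g"
    and "\<And>x. x \<in> topspace X \<Longrightarrow> closed_segment (f x) (g x) \<subseteq> T"
  shows "homotopic_with (\<lambda>_. True) X (top_of_set T) f g"
proof -
  let ?K = "{(a, b). closed_segment a b \<subseteq> T}"
  have "homotopic_with (\<lambda>_. True) (top_of_set ?K) (top_of_set T) fst snd"
    by (intro homotopic_with_linear continuous_intros) auto
  moreover have "continuous_map X (top_of_set ?K) (\<lambda>x. (f x, g x))"
    using continuous_map_pairedI[OF assms(1,2)] assms(3)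
    by (auto simp: continuous_map_in_subtopology)
  ultimately have "homotopic_with (\<lambda>_. True) X (top_of_set T)
      (fst \<circ> (\<lambda>x. (f x, g x))) (snd \<circ> (\<lambda>x. (f x, g x)))"
    by (rule homotopic_with_compose_continuous_map_right) simp
  then show ?thesis
    by (simp add: o_def)
qed

text \<open>A continuous section, over nonzero \<open>v\<close>, of the map taking a matrix in
  \<open>SL2C\<close> to its first column: the second column is the vector orthogonal to
  \<open>v\<close> with entries \<open>- cnj (v $ 2)\<close> and \<open>cnj (v $ 1)\<close>, divided
  by the squared norm of \<open>v\<close> so that the determinant is 1.\<close>

definition complete_column :: "complex ^ 2 \<Rightarrow> complex ^ 2 ^ 2" where
  "complete_column v = (\<chi> i j. if j = 1 then v $ i
     else if i = 1 then - cnj (v $ 2) / of_real ((norm (v $ 1))\<^sup>2 + (norm (v $ 2))\<^sup>2)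
     else cnj (v $ 1) / of_real ((norm (v $ 1))\<^sup>2 + (norm (v $ 2))\<^sup>2))"

lemma sum_norm_squares_nonzero:
  fixes v :: "complex ^ 2"
  assumes "v \<noteq> 0"
  shows "(norm (v $ 1))\<^sup>2 + (norm (v $ 2))\<^sup>2 \<noteq> 0"
  using assms by (auto simp: vec_eq_iff forall_2 sum_power2_eq_zero_iff)

lemma complete_column_in_SL2C:
  assumes "v \<noteq> 0"
  shows "complete_column v \<in> SL2C"
proof -
  let ?n = "complex_of_real ((norm (v $ 1))\<^sup>2 + (norm (v $ 2))\<^sup>2)"
  have "?n \<noteq> 0"
    using sum_norm_squares_nonzero[OF assms] by (metis of_real_eq_0_iff)
  moreover have "?n = v $ 1 * cnj (v $ 1) + v $ 2 * cnj (v $ 2)"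
    by (simp flip: complex_norm_square)
  moreover have "det (complete_column v) = (v $ 1 * cnj (v $ 1) + v $ 2 * cnj (v $ 2)) / ?n"
    by (simp add: complete_column_def det_2 add_divide_distrib mult.commute del: of_real_add)
  ultimately show ?thesis
    by (simp add: SL2C_def)
qed

lemma continuous_on_complete_column:
  "continuous_on (- {0}) complete_column"
  unfolding complete_column_def
proof (intro continuous_on_vec_lambda)
  fix i j :: 2
  show "continuous_on (- {0}) (\<lambda>v::complex^2. if j = 1 then v $ i
     else if i = 1 then - cnj (v $ 2) / of_real ((norm (v $ 1))\<^sup>2 + (norm (v $ 2))\<^sup>2)
     else cnj (v $ 1) / of_real ((norm (v $ 1))\<^sup>2 + (norm (v $ 2))\<^sup>2))"
    using sum_norm_squares_nonzero
    by (cases "j = 1"; cases "i = 1")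
      (auto intro!: continuous_intros simp del: of_real_add simp: of_real_eq_0_iff)
qed

lemma complete_column_axis: "complete_column (axis 1 1) = mat 1"
  by (simp add: complete_column_def vec_eq_iff forall_2 axis_def mat_def)

theorem theorem4p1:
  fixes S :: "'a topology"
    and \<A> :: "('a, 2) chart set"
    and A :: "'a \<Rightarrow> complex ^ 2 ^ 2"
  assumes "smooth_manifold S \<A>"
    and "compact_space S"
    and "connected_space S"
    and "orientable S \<A>"
    and "smooth_map_into S \<A> SL2C A"
  shows "homotopic_with (\<lambda>_. True) S (top_of_set SL2C) A (\<lambda>_. mat 1)"
proof -
  let ?v = "\<lambda>p. column 1 (A p)"
  have atlas: "smooth_atlas S \<A>"
    using assms(1) by (simp add: smooth_manifold_def)
  have SL: "A p \<in> SL2C" if "p \<in> topspace S" for p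
    using assms(5) that by (auto simp: smooth_map_into_def)
  have contA: "continuous_map S euclidean A"
    using smooth_map_into_imp_continuous_map[OF atlas assms(5)]
    by (simp add: continuous_map_in_subtopology)
  have lin: "linear (column 1 :: complex ^ 2 ^ 2 \<Rightarrow> complex ^ 2)"
    by (intro linearI) (simp_all add: column_def vec_eq_iff)
  have contv: "continuous_map S euclidean ?v"
    using continuous_map_compose[OF contA, of euclidean "column 1"]
      linear_continuous_on[OF linear_conv_bounded_linear[THEN iffD1, OF lin], of UNIV]
    by (simp add: o_def)
  have v_nz: "?v p \<noteq> 0" if "p \<in> topspace S" for p
  proof
    assume "?v p = 0"
    then have "A p $ i $ 1 = 0" for i
      by (simp add: column_def vec_eq_iff)
    then show False
      using SL[OF that] by (simp add: SL2C_def det_2)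
  qed
  have contvp: "continuous_map S (top_of_set (- {0})) ?v"
    using contv v_nz by (auto simp: continuous_map_in_subtopology)

  \<comment> \<open>The cone has at most 2 + 1 real parameters, while \<open>complex ^ 2\<close> has
    real dimension 4.\<close>
  define C where "C = {r *\<^sub>R ?v p | r p. p \<in> topspace S}"
  have "negligible C"
    unfolding C_def by (rule negligible_cone_over_smooth_image[OF atlas assms(2,5) lin]) simp
  \<comment> \<open>Adding 0 forces \<open>u \<noteq> 0\<close> even when \<open>S\<close> is empty,
    in which case \<open>C\<close> is empty too.\<close>
  then have "negligible (insert 0 C)"
    by simp
  then have "insert 0 C \<noteq> UNIV"
    by (metis non_negligible_UNIV)
  then obtain u where u: "u \<noteq> 0" "u \<notin> C"
    by auto
  have "homotopic_with (\<lambda>_. True) S (top_of_set (- {0})) ?v (\<lambda>_. - u)"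
  proof (rule homotopic_with_linear_topology[OF contv])
    fix p assume p: "p \<in> topspace S"
    show "closed_segment (?v p) (- u) \<subseteq> - {0}"
    proof clarsimp
      \<comment> \<open>A zero on the segment would give either a vanishing first column
        (\<open>t = 0\<close>) or \<open>u\<close> as a real multiple of it, contradicting the
        choice of \<open>u\<close>.\<close>
      assume "0 \<in> closed_segment (?v p) (- u)"
      then obtain t where t: "(1 - t) *\<^sub>R ?v p = t *\<^sub>R u"
        by (auto simp: in_segment)
      show False
      proof (cases "t = 0")
        case True
        then show False using t v_nz[OF p] by simp
      next
        case False
        then have "u = ((1 - t) / t) *\<^sub>R ?v p"
          using arg_cong[OF t, of "\<lambda>x. (1 / t) *\<^sub>R x"] by simp
        then show False using u p by (auto simp: C_def)
      qed
    qed
  qed simp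
  \<comment> \<open>The target \<open>axis 1 1\<close> is chosen because
    \<open>complete_column\<close> sends it to the identity matrix.\<close>
  moreover have "homotopic_with (\<lambda>_. True) S (top_of_set (- {0 :: complex ^ 2}))
      (\<lambda>_. - u) (\<lambda>_. axis 1 1)"
  proof -
    have "path_connected (- {0 :: complex ^ 2})"
      by (rule path_connected_punctured_universe) simp
    then have "path_component (- {0 :: complex ^ 2}) (- u) (axis 1 1)"
      using u by (auto simp: path_connected_component axis_eq_0_iff)
    then show ?thesis
      by (simp add: homotopic_constant_maps)
  qed
  ultimately have "homotopic_with (\<lambda>_. True) S (top_of_set (- {0})) ?v (\<lambda>_. axis 1 1)"
    by (rule homotopic_with_trans)
  moreover have contc: "continuous_map (top_of_set (- {0})) (top_of_set SL2C) complete_column"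
    using continuous_on_complete_column complete_column_in_SL2C by auto
  ultimately have "homotopic_with (\<lambda>_. True) S (top_of_set SL2C)
      (complete_column \<circ> ?v) (complete_column \<circ> (\<lambda>_. axis 1 1))"
    by (rule homotopic_with_compose_continuous_map_left) simp
  \<comment> \<open>Both matrices have the same first column, and the determinant is linear in the
    second, so it stays equal to 1 along the segment joining them.\<close>
  moreover have "homotopic_with (\<lambda>_. True) S (top_of_set SL2C) A (complete_column \<circ> ?v)"
  proof (rule homotopic_with_linear_topology[OF contA])
    show "continuous_map S euclidean (complete_column \<circ> ?v)"
      using continuous_map_compose[OF contvp contc] by (simp add: continuous_map_in_subtopology)
    fix p assume p: "p \<in> topspace S"
    let ?B = "complete_column (?v p)"
    have col: "?B $ i $ 1 = A p $ i $ 1" for i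
      by (simp add: complete_column_def column_def)
    have dets: "det (A p) = 1" "det ?B = 1"
      using SL[OF p] complete_column_in_SL2C[OF v_nz[OF p]] by (simp_all add: SL2C_def)
    have "det ((1 - t) *\<^sub>R A p + t *\<^sub>R ?B) = (1 - t) *\<^sub>R det (A p) + t *\<^sub>R det ?B" for t
      unfolding det_2 by (simp add: col scaleR_conv_of_real[where 'a = complex] algebra_simps)
    then show "closed_segment (A p) ((complete_column \<circ> ?v) p) \<subseteq> SL2C"
      using dets by (auto simp: in_segment SL2C_def scaleR_conv_of_real[where 'a = complex])
  qed
  ultimately show ?thesis
    by (auto simp: complete_column_axis o_def dest: homotopic_with_trans)
qed

end
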